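(* Let $\lambda\in\mathbb{R}\setminus\{0\}$ and let $\psi\in\mathcal{D}_{W,V}(\mathbb{T})$ satisfy $$-\Delta_{W,V}\psi=\lambda\psi .$$ Then $\psi\in C^{\infty}_{W,V,0}(\mathbb{T}):=\bigcap_{n\in\mathbb{N}}C^{n}_{W,V,0}(\mathbb{T})$ (i.e. the $L^2_V$-class $\psi$ has a representative in this space).
   Context: Notation. $\mathbb{T}=\mathbb{R}/\mathbb{Z}$; functions on $\mathbb{T}$ are identified with $1$-periodic functions on $\mathbb{R}$. Càdlàg means right-continuous with left limits; càglàd means left-continuous with right limits. $W,V:\mathbb{R}\to\mathbb{R}$ are strictly increasing, $W$ is càdlàg, $V$ is càglàd, and $W(x+1)-W(x)=W(1)-W(0)$, $V(x+1)-V(x)=V(1)-V(0)$ for all $x\in\mathbb{R}$; both are continuous at $0$ and $W(0)=V(0)=0$. No further continuity is assumed. $dW$ and $dV$ are the induced finite Borel measures on $\mathbb{T}$, with $dW((a,b])=W(b)-W(a)$ and $dV([a,b))=V(b)-V(a)$. $L^2_W(\mathbb{T})$, $L^2_V(\mathbb{T})$ are the corresponding (real) $L^2$ spaces, with norms $\|\cdot\|_W,\|\cdot\|_V$ and inner products $\langle\cdot,\cdot\rangle_W,\langle\cdot,\cdot\rangle_V$; $L^2_{W,0}(\mathbb{T})=\{F\in L^2_W(\mathbb{T}):\int_{\mathbb{T}}F\,dW=0\}$, and similarly $L^2_{V,0}(\mathbb{T})$. Lateral derivatives: $D^-_Wf(x)=\lim_{h\to0^-}\frac{f(x+h)-f(x)}{W(x+h)-W(x)}$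 and $D^+_Vg(x)=\lim_{h\to0^+}\frac{g(x+h)-g(x)}{V(x+h)-V(x)}$; a function is $W$-left (resp. $V$-right) differentiable if the limit exists at every $x\in\mathbb{T}$. $\mathfrak{D}_{W,V}(\mathbb{T})$ is the set of càdlàg $f:\mathbb{T}\to\mathbb{R}$ that are $W$-left differentiable, with $D^-_Wf$ càglàd and $V$-right differentiable, and $D^+_VD^-_Wf$ càdlàg. The operator $I-D^+_VD^-_W:\mathfrak{D}_{W,V}(\mathbb{T})\subset L^2_V(\mathbb{T})\to L^2_V(\mathbb{T})$ is symmetric and strongly positive; $\mathcal{A}:\mathcal{D}_{W,V}(\mathbb{T})\subseteq L^2_V(\mathbb{T})\to L^2_V(\mathbb{T})$ denotes its Friedrichs extension, and $\Delta_{W,V}:=I-\mathcal{A}$. Explicitly, $\mathcal{D}_{W,V}(\mathbb{T})$ is the set of $f\in L^2_V(\mathbb{T})$ for which there are $a,b\in\mathbb{R}$ and $\mathfrak{f}\in L^2_{V,0}(\mathbb{T})$ with $$f(x)=a+bW(x)+\int_{(0,x]}\int_{[0,y)}\mathfrak{f}(s)\,dV(s)\,dW(y)\quad V\text{-a.e. } x\in[0,1),\qquad bW(1)+\int_{(0,1]}\int_{[0,y)}\mathfrak{f}(s)\,dV(s)\,dW(y)=0,$$ and then $\Delta_{W,V}f=\mathfrak{f}$. Smooth spaces: $C_0(\mathbb{T})=\{f:\mathbb{T}\to\mathbb{R}\text{ càdlàg},\ \int_{\mathbb{T}}f\,dV=0\}$, $C_1(\mathbb{T})=\{f:\mathbb{T}\to\mathbb{R}\text{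 càglàd},\ \int_{\mathbb{T}}f\,dW=0\}$. For $n\ge1$, $D^{(n)}_{W,V}$ is the alternating composition of $n$ lateral derivatives in which $D^-_W$ is applied first: $D^{(1)}_{W,V}=D^-_W$, $D^{(2)}_{W,V}=D^+_VD^-_W$, $D^{(3)}_{W,V}=D^-_WD^+_VD^-_W$, and so on. $\sigma(n)=1$ for $n$ odd and $\sigma(n)=0$ for $n$ even. $C^n_{W,V,0}(\mathbb{T})=\{f\in C_0(\mathbb{T}): D^{(k)}_{W,V}f\text{ exists (at every point of }\mathbb{T})\text{ and }D^{(k)}_{W,V}f\in C_{\sigma(k)}(\mathbb{T})\text{ for all }k\le n\}$. *)

theory Defs
  imports "HOL-Analysis.Analysis"
begin

text \<open>Functions on the torus \<open>\<real>/\<int>\<close> are 1-periodic functions on \<open>\<real>\<close>.\<close>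

definition periodic1 :: "(real \<Rightarrow> real) \<Rightarrow> bool" where
  "periodic1 f \<longleftrightarrow> (\<forall>x. f (x + 1) = f x)"

definition cadlag :: "(real \<Rightarrow> real) \<Rightarrow> bool" where
  "cadlag f \<longleftrightarrow> (\<forall>x. continuous (at_right x) f \<and> (\<exists>l. (f \<longlongrightarrow> l) (at_left x)))"

definition caglad :: "(real \<Rightarrow> real) \<Rightarrow> bool" where
  "caglad f \<longleftrightarrow> (\<forall>x. continuous (at_left x) f \<and> (\<exists>l. (f \<longlongrightarrow> l) (at_right x)))"


text \<open>
  The measures \<open>dW\<close> and \<open>dV\<close> are taken on the whole line; integrals over the torus are
  integrals over a fundamental domain. As \<open>W\<close> and \<open>V\<close> will be continuous at \<open>0\<close>, there is no
  atom at an integer and the choice of the fundamental domain is immaterial.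

  Since \<open>V\<close> is left-continuous, \<^const>\<open>interval_measure\<close> does not apply to it directly:
  \<open>dV\<close> is the reflection at \<open>0\<close> of the measure of the right-continuous function
  \<open>x \<mapsto> - V (- x)\<close>.
\<close>

definition dW :: "(real \<Rightarrow> real) \<Rightarrow> real measure" where
  "dW W = interval_measure W"

definition dV :: "(real \<Rightarrow> real) \<Rightarrow> real measure" where
  "dV V = distr (interval_measure (\<lambda>x. - V (- x))) borel uminus"

lemma emeasure_dW:
  assumes "strict_mono W" "cadlag W" "a \<le> b"
  shows "emeasure (dW W) {a<..b} = ennreal (W b - W a)"
  unfolding dW_def using assms
  by (intro emeasure_interval_measure_Ioc)
    (auto simp: cadlag_def strict_mono_less_eq)

lemma emeasure_dV:
  assumes "strict_mono V" "caglad V" "a \<le> b"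
  shows "emeasure (dV V) {a..<b} = ennreal (V b - V a)"
proof -
  have rc: "continuous (at_right x) (\<lambda>x. - V (- x))" for x
  proof -
    have "(V \<longlongrightarrow> V (- x)) (at_left (- x))"
      using assms(2) by (auto simp: caglad_def continuous_within)
    hence "((\<lambda>y. V (- y)) \<longlongrightarrow> V (- x)) (at_right x)"
      by (subst (asm) at_left_minus) (simp add: filterlim_filtermap)
    thus ?thesis by (auto simp: continuous_within intro: tendsto_minus)
  qed
  have "uminus -` {a..<b} = {- b<..- a}" by auto
  hence "emeasure (dV V) {a..<b} = emeasure (interval_measure (\<lambda>x. - V (- x))) {- b<..- a}"
    unfolding dV_def by (subst emeasure_distr) auto
  also have "\<dots> = ennreal (V b - V a)"
    using assms rc by (subst emeasure_interval_measure_Ioc) (auto simp: strict_mono_less_eq)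
  finally show ?thesis .
qed


text \<open>
  Square integrable functions, not quotiented: equality in \<open>L\<^sup>2\<^sub>V\<close> is \<open>V\<close>-a.e. equality
  on \<open>[0,1)\<close>.
\<close>

definition L2V :: "(real \<Rightarrow> real) \<Rightarrow> (real \<Rightarrow> real) set" where
  "L2V V = {f. periodic1 f \<and> f \<in> borel_measurable borel \<and>
               set_integrable (dV V) {0..<1} (\<lambda>x. (f x)\<^sup>2)}"

definition eq_V :: "(real \<Rightarrow> real) \<Rightarrow> (real \<Rightarrow> real) \<Rightarrow> (real \<Rightarrow> real) \<Rightarrow> bool" where
  "eq_V V f g \<longleftrightarrow> (AE x in dV V. x \<in> {0..<1} \<longrightarrow> f x = g x)"

definition L2V0 :: "(real \<Rightarrow> real) \<Rightarrow> (real \<Rightarrow> real) set" where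
  "L2V0 V = {f \<in> L2V V. (LINT x:{0..<1}|dV V. f x) = 0}"


text \<open>
  The graph of \<open>\<Delta> = I - A\<close>, where \<open>A\<close> is the Friedrichs extension of \<open>I - D\<^sup>+\<^sub>V D\<^sup>-\<^sub>W\<close>, through the
  explicit description of the domain of \<open>A\<close> as double integrals.
\<close>

definition Laplacian_graph ::
  "(real \<Rightarrow> real) \<Rightarrow> (real \<Rightarrow> real) \<Rightarrow> (real \<Rightarrow> real) \<Rightarrow> (real \<Rightarrow> real) \<Rightarrow> bool" where
  "Laplacian_graph W V f g \<longleftrightarrow> f \<in> L2V V \<and> g \<in> L2V0 V \<and>
     (\<exists>a b. eq_V V f (\<lambda>x. a + b * W x + (LINT y:{0<..x}|dW W. (LINT s:{0..<y}|dV V. g s))) \<and>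
            b * W 1 + (LINT y:{0<..1}|dW W. (LINT s:{0..<y}|dV V. g s)) = 0)"

definition Laplacian_dom :: "(real \<Rightarrow> real) \<Rightarrow> (real \<Rightarrow> real) \<Rightarrow> (real \<Rightarrow> real) set" where
  "Laplacian_dom W V = {f. \<exists>g. Laplacian_graph W V f g}"

text \<open>The choice only picks a representative: \<open>g\<close> is determined by \<open>f\<close> up to \<^const>\<open>eq_V\<close>.\<close>

definition Laplacian :: "(real \<Rightarrow> real) \<Rightarrow> (real \<Rightarrow> real) \<Rightarrow> (real \<Rightarrow> real) \<Rightarrow> real \<Rightarrow> real" where
  "Laplacian W V f = (SOME g. Laplacian_graph W V f g)"


definition diff_quot :: "(real \<Rightarrow> real) \<Rightarrow> (real \<Rightarrow> real) \<Rightarrow> real \<Rightarrow> real \<Rightarrow> real" where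
  "diff_quot U f x h = (f (x + h) - f x) / (U (x + h) - U x)"

definition W_left_differentiable :: "(real \<Rightarrow> real) \<Rightarrow> (real \<Rightarrow> real) \<Rightarrow> bool" where
  "W_left_differentiable W f \<longleftrightarrow> (\<forall>x. \<exists>d. (diff_quot W f x \<longlongrightarrow> d) (at_left 0))"

definition V_right_differentiable :: "(real \<Rightarrow> real) \<Rightarrow> (real \<Rightarrow> real) \<Rightarrow> bool" where
  "V_right_differentiable V f \<longleftrightarrow> (\<forall>x. \<exists>d. (diff_quot V f x \<longlongrightarrow> d) (at_right 0))"

definition DW_left :: "(real \<Rightarrow> real) \<Rightarrow> (real \<Rightarrow> real) \<Rightarrow> real \<Rightarrow> real" where
  "DW_left W f x = Lim (at_left 0) (diff_quot W f x)"

definition DV_right :: "(real \<Rightarrow> real) \<Rightarrow> (real \<Rightarrow> real) \<Rightarrow> real \<Rightarrow> real" where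
  "DV_right V f x = Lim (at_right 0) (diff_quot V f x)"

text \<open>Alternating derivatives, \<^const>\<open>DW_left\<close> being applied first; meaningful under \<open>D_iter_exists\<close>.\<close>

fun D_iter :: "(real \<Rightarrow> real) \<Rightarrow> (real \<Rightarrow> real) \<Rightarrow> nat \<Rightarrow> (real \<Rightarrow> real) \<Rightarrow> real \<Rightarrow> real" where
  "D_iter W V 0 f = f"
| "D_iter W V (Suc n) f =
     (if even n then DW_left W (D_iter W V n f) else DV_right V (D_iter W V n f))"

fun D_iter_exists :: "(real \<Rightarrow> real) \<Rightarrow> (real \<Rightarrow> real) \<Rightarrow> nat \<Rightarrow> (real \<Rightarrow> real) \<Rightarrow> bool" where
  "D_iter_exists W V 0 f \<longleftrightarrow> True"
| "D_iter_exists W V (Suc n) f \<longleftrightarrow> D_iter_exists W V n f \<and>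
     (if even n then W_left_differentiable W (D_iter W V n f)
      else V_right_differentiable V (D_iter W V n f))"


definition C0 :: "(real \<Rightarrow> real) \<Rightarrow> (real \<Rightarrow> real) set" where
  "C0 V = {f. periodic1 f \<and> cadlag f \<and> (LINT x:{0..<1}|dV V. f x) = 0}"

definition C1 :: "(real \<Rightarrow> real) \<Rightarrow> (real \<Rightarrow> real) set" where
  "C1 W = {f. periodic1 f \<and> caglad f \<and> (LINT x:{0<..1}|dW W. f x) = 0}"

definition C_smooth :: "(real \<Rightarrow> real) \<Rightarrow> (real \<Rightarrow> real) \<Rightarrow> nat \<Rightarrow> (real \<Rightarrow> real) set" where
  "C_smooth W V n = {f \<in> C0 V. \<forall>k\<le>n. D_iter_exists W V k f \<and>
                                 D_iter W V k f \<in> (if odd k then C1 W else C0 V)}"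

definition C_inf :: "(real \<Rightarrow> real) \<Rightarrow> (real \<Rightarrow> real) \<Rightarrow> (real \<Rightarrow> real) set" where
  "C_inf W V = (\<Inter>n. C_smooth W V n)"

end

theory Submission
  imports Defs
begin

text \<open>
  Let \<open>g = \<Delta>\<psi>\<close>, so that \<open>g = - \<lambda> \<psi>\<close> almost everywhere, and let \<open>G y\<close> be the integral of \<open>g\<close> over
  \<open>[0,y)\<close>. The representation of \<open>\<psi>\<close> as a double integral provides the representative
  \<open>\<phi> x = a + b W x + \<integral>\<^bsub>(0,x]\<^esub> G dW\<close> on the period \<open>[0,1]\<close>; the boundary condition says
  \<open>\<phi> 1 = \<phi> 0\<close>, so \<open>\<phi>\<close> extends periodically. Put \<open>d = b + G\<close>; as \<open>g\<close> has integral \<open>0\<close>,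
  \<open>G 1 = 0 = G 0\<close> and \<open>d\<close> is periodic too. The whole theorem is the pair of identities, valid
  at every point,
  \<open>D\<^sup>-\<^sub>W \<phi> = d\<close> and \<open>D\<^sup>+\<^sub>V d = - \<lambda> \<phi>\<close>:
  they make \<open>\<phi>\<close> infinitely differentiable, since the iterated derivatives of \<open>\<phi>\<close> are just
  multiples of \<open>\<phi>\<close> and \<open>d\<close> in turn (\<open>C_inf_if_eigenfunction\<close>).

  Each identity is a fundamental theorem of calculus: a difference quotient of a primitive is an
  average of the integrand over a half-open interval shrinking to one of its end points, and the
  integrand is continuous from that side (\<open>diff_quot_primitive_dW\<close>,
  \<open>diff_quot_primitive_dV\<close>). In the second identity the integrand \<open>g\<close> is merely almost
  everywhere equal to the right-continuous function \<open>- \<lambda> \<phi>\<close>; averages do not see the difference,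
  and this is how the equation in \<open>L\<^sup>2\<^sub>V\<close> turns into one at every point.

  The regularity that is needed comes in alternation. Since \<open>G\<close> is bounded, the increments of
  \<open>\<phi>\<close> are at most a constant times those of \<open>W\<close>, so \<open>\<phi>\<close> is bounded and inherits from \<open>W\<close> that
  it is cadlag; now \<open>g\<close> is bounded almost everywhere, the increments of \<open>d\<close> are at most a constant
  times those of \<open>V\<close>, and \<open>d\<close> is caglad like \<open>V\<close>. Finally \<open>d\<close> has integral \<open>0\<close> because
  \<open>\<phi> 1 = \<phi> 0\<close>, and \<open>\<phi>\<close> has integral \<open>0\<close> because \<open>g\<close> has and \<open>\<lambda> \<noteq> 0\<close>.
\<close>

section \<open>Periodic functions\<close>

text \<open>
  The statements about \<open>P\<close> below are applied to local properties, such as one-sided continuity at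
  a point, which need then only be checked on one period.
\<close>

lemma shift_invariant_of_int:
  fixes P :: "real \<Rightarrow> 'b"
  assumes "\<And>x. P (x + 1) = P x"
  shows "P (x + of_int k) = P x"
proof (induction k rule: int_induct[where k = 0])
  case (step1 i)
  then show ?case using assms[of "x + of_int i"] by (simp add: add_ac)
next
  case (step2 i)
  then show ?case using assms[of "x + of_int (i - 1)"] by (simp add: add_ac)
qed simp

lemma shift_invariant_frac:
  fixes P :: "real \<Rightarrow> 'b"
  assumes "\<And>x. P (x + 1) = P x"
  shows "P (frac x) = P x"
  using shift_invariant_of_int[of P x "- \<lfloor>x\<rfloor>", OF assms] by (simp add: frac_def)

lemma shift_invariant_right:
  assumes "\<And>x::real. P (x + 1) = P x" and "\<And>x. 0 \<le> x \<Longrightarrow> x < 1 \<Longrightarrow> P x"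
  shows "P x"
  using shift_invariant_frac[of P x, OF assms(1)] assms(2)[of "frac x"]
  by (simp add: frac_lt_1)

text \<open>
  This is the version for properties of the germ of a function to the left of a point: functions
  will be known explicitly on \<open>[0,1]\<close>, which contains a left neighbourhood of \<open>1\<close> but none of
  \<open>0\<close>.
\<close>

lemma shift_invariant_left:
  assumes shift: "\<And>x::real. P (x + 1) = P x" and P: "\<And>x. 0 < x \<Longrightarrow> x \<le> 1 \<Longrightarrow> P x"
  shows "P x"
proof (cases "x \<in> \<int>")
  case True
  then have "P x = P 0"
    using shift_invariant_frac[of P x, OF shift] by (metis frac_eq_0_iff)
  also have "\<dots> = P 1" using shift[of 0] by simp
  finally show ?thesis using P[of 1] by simp
next
  case False
  then have "P (frac x)" using P[of "frac x"] frac_lt_1[of x] by (simp add: less_imp_le)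
  then show ?thesis using shift_invariant_frac[of P x, OF shift] by simp
qed

lemma tendsto_shift1:
  fixes f :: "real \<Rightarrow> real"
  assumes "periodic1 f"
  shows "(f \<longlongrightarrow> l) (at_left (x + 1)) \<longleftrightarrow> (f \<longlongrightarrow> l) (at_left x)"
    and "(f \<longlongrightarrow> l) (at_right (x + 1)) \<longleftrightarrow> (f \<longlongrightarrow> l) (at_right x)"
proof -
  have f: "(\<lambda>y. f (y + 1)) = f" using assms by (auto simp: periodic1_def)
  have "at_left (x + 1) = filtermap (\<lambda>y. y + 1) (at_left x)"
    using filtermap_at_left_shift[of "-1" x] by simp
  then show "(f \<longlongrightarrow> l) (at_left (x + 1)) \<longleftrightarrow> (f \<longlongrightarrow> l) (at_left x)"
    by (simp add: filterlim_filtermap f)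
  have "at_right (x + 1) = filtermap (\<lambda>y. y + 1) (at_right x)"
    using filtermap_at_right_shift[of "-1" x] by simp
  then show "(f \<longlongrightarrow> l) (at_right (x + 1)) \<longleftrightarrow> (f \<longlongrightarrow> l) (at_right x)"
    by (simp add: filterlim_filtermap f)
qed

lemma cadlag_if_on_period:
  assumes per: "periodic1 f"
    and r: "\<And>x. 0 \<le> x \<Longrightarrow> x < 1 \<Longrightarrow> (f \<longlongrightarrow> f x) (at_right x)"
    and l: "\<And>x. 0 < x \<Longrightarrow> x \<le> 1 \<Longrightarrow> \<exists>l. (f \<longlongrightarrow> l) (at_left x)"
  shows "cadlag f"
proof -
  have f: "f (x + 1) = f x" for x using per by (simp add: periodic1_def)
  have "(f \<longlongrightarrow> f x) (at_right x)" for x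
    by (rule shift_invariant_right[where P = "\<lambda>x. (f \<longlongrightarrow> f x) (at_right x)"])
      (use r in \<open>simp_all add: tendsto_shift1[OF per] f\<close>)
  moreover have "\<exists>l. (f \<longlongrightarrow> l) (at_left x)" for x
    by (rule shift_invariant_left[where P = "\<lambda>x. \<exists>l. (f \<longlongrightarrow> l) (at_left x)"])
      (use l in \<open>simp_all add: tendsto_shift1[OF per]\<close>)
  ultimately show ?thesis by (simp add: cadlag_def continuous_within)
qed

lemma caglad_if_on_period:
  assumes per: "periodic1 f"
    and r: "\<And>x. 0 \<le> x \<Longrightarrow> x < 1 \<Longrightarrow> \<exists>l. (f \<longlongrightarrow> l) (at_right x)"
    and l: "\<And>x. 0 < x \<Longrightarrow> x \<le> 1 \<Longrightarrow> (f \<longlongrightarrow> f x) (at_left x)"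
  shows "caglad f"
proof -
  have f: "f (x + 1) = f x" for x using per by (simp add: periodic1_def)
  have "(f \<longlongrightarrow> f x) (at_left x)" for x
    by (rule shift_invariant_left[where P = "\<lambda>x. (f \<longlongrightarrow> f x) (at_left x)"])
      (use l in \<open>simp_all add: tendsto_shift1[OF per] f\<close>)
  moreover have "\<exists>l. (f \<longlongrightarrow> l) (at_right x)" for x
    by (rule shift_invariant_right[where P = "\<lambda>x. \<exists>l. (f \<longlongrightarrow> l) (at_right x)"])
      (use r in \<open>simp_all add: tendsto_shift1[OF per]\<close>)
  ultimately show ?thesis by (simp add: caglad_def continuous_within)
qed

lemma diff_quot_shift1:
  assumes "periodic1 f" and "\<And>x. U (x + 1) - U x = U 1 - U (0::real)"
  shows "diff_quot U f (x + 1) = diff_quot U f x"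
proof
  fix h
  have "f (x + 1 + h) = f (x + h)" "f (x + 1) = f x"
    using assms(1) by (metis add.commute add.left_commute periodic1_def)+
  moreover have "U (x + 1 + h) - U (x + 1) = U (x + h) - U x"
    using assms(2)[of "x + h"] assms(2)[of x] by (simp add: add_ac)
  ultimately show "diff_quot U f (x + 1) h = diff_quot U f x h"
    by (simp add: diff_quot_def)
qed

section \<open>Functions whose increments are controlled by another function\<close>

text \<open>
  A function whose increments are bounded by a multiple of those of \<open>U\<close> inherits the one-sided
  limits and the one-sided continuity of \<open>U\<close>. This is how \<open>dW\<close>-primitives become cadlag and
  \<open>dV\<close>-primitives caglad.
\<close>

lemma tendsto_if_increments_le:
  fixes f U :: "real \<Rightarrow> real"
  assumes K: "\<And>x y. x \<in> S \<Longrightarrow> y \<in> S \<Longrightarrow> \<bar>f x - f y\<bar> \<le> K * \<bar>U x - U y\<bar>"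
    and S: "x \<in> S" "eventually (\<lambda>y. y \<in> S) G" and U: "(U \<longlongrightarrow> U x) G"
  shows "(f \<longlongrightarrow> f x) G"
proof -
  have "((\<lambda>y. K * \<bar>U y - U x\<bar>) \<longlongrightarrow> K * \<bar>U x - U x\<bar>) G"
    by (intro tendsto_intros U)
  then have "((\<lambda>y. K * \<bar>U y - U x\<bar>) \<longlongrightarrow> 0) G" by simp
  moreover have "eventually (\<lambda>y. norm (f y - f x) \<le> K * \<bar>U y - U x\<bar>) G"
    using S(2) by eventually_elim (use K S(1) in auto)
  ultimately have "((\<lambda>y. f y - f x) \<longlongrightarrow> 0) G" by (rule Lim_null_comparison[rotated])
  then show ?thesis by (simp add: LIM_zero_iff)
qed

text \<open>The values of \<open>f\<close> along the filter are Cauchy because those of \<open>U\<close> are.\<close>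

lemma convergent_if_increments_le:
  fixes f U :: "real \<Rightarrow> real"
  assumes K: "\<And>x y. x \<in> S \<Longrightarrow> y \<in> S \<Longrightarrow> \<bar>f x - f y\<bar> \<le> K * \<bar>U x - U y\<bar>"
    and S: "eventually (\<lambda>y. y \<in> S) G" and U: "(U \<longlongrightarrow> u) G" and G: "G \<noteq> bot"
  shows "\<exists>l. (f \<longlongrightarrow> l) G"
proof -
  have "\<exists>P. eventually P G \<and> (\<forall>x y. P x \<and> P y \<longrightarrow> dist (f x) (f y) < e)" if "e > 0" for e
  proof -
    define q where "q = \<bar>K\<bar> + 1"
    have q: "q > 0" "K \<le> q" by (auto simp: q_def)
    define r where "r = e / (2 * q)"
    have r: "r > 0" using that q by (simp add: r_def)
    let ?P = "\<lambda>y. y \<in> S \<and> dist (U y) u < r"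
    have "eventually ?P G"
      using S tendstoD[OF U r] by eventually_elim auto
    moreover have "dist (f x) (f y) < e" if "?P x" "?P y" for x y
    proof -
      have "\<bar>U x - U y\<bar> < 2 * r" using that by (auto simp: dist_real_def)
      have "dist (f x) (f y) \<le> K * \<bar>U x - U y\<bar>"
        using K that by (auto simp: dist_real_def)
      also have "\<dots> \<le> q * \<bar>U x - U y\<bar>" using q by (intro mult_right_mono) auto
      also have "\<dots> < q * (2 * r)"
        using q \<open>\<bar>U x - U y\<bar> < 2 * r\<close> by (intro mult_strict_left_mono) auto
      also have "\<dots> = e" using q by (simp add: r_def)
      finally show ?thesis .
    qed
    ultimately show ?thesis by blast
  qed
  then have "cauchy_filter (filtermap f G)" by (simp add: cauchy_filter_metric_filtermap)
  moreover have "complete (UNIV :: real set)" by (rule complete_UNIV)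
  ultimately have "\<exists>l. filtermap f G \<le> nhds l"
    using G unfolding complete_uniform by (auto simp: filtermap_bot_iff)
  then show ?thesis by (simp add: filterlim_def)
qed

lemma eventually_at_left_period:
  "0 < x \<Longrightarrow> x \<le> 1 \<Longrightarrow> eventually (\<lambda>y. y \<in> {0..1::real}) (at_left x)"
  unfolding eventually_at_left by (metis atLeastAtMost_iff less_eq_real_def order_trans)

lemma eventually_at_right_period:
  "0 \<le> x \<Longrightarrow> x < 1 \<Longrightarrow> eventually (\<lambda>y. y \<in> {0..1::real}) (at_right x)"
  unfolding eventually_at_right by (metis atLeastAtMost_iff less_eq_real_def order_trans)

lemma cadlag_if_increments_le:
  assumes "periodic1 f" and U: "cadlag U"
    and K: "\<And>x y. x \<in> {0..1} \<Longrightarrow> y \<in> {0..1} \<Longrightarrow> \<bar>f x - f y\<bar> \<le> K * \<bar>U x - U y\<bar>"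
  shows "cadlag f"
proof (rule cadlag_if_on_period[OF assms(1)])
  fix x :: real assume "0 \<le> x" "x < 1"
  then show "(f \<longlongrightarrow> f x) (at_right x)"
    using U by (intro tendsto_if_increments_le[where S = "{0..1}", OF K] eventually_at_right_period)
      (auto simp: cadlag_def continuous_within)
next
  fix x :: real assume "0 < x" "x \<le> 1"
  moreover obtain u where "(U \<longlongrightarrow> u) (at_left x)" using U by (auto simp: cadlag_def)
  ultimately show "\<exists>l. (f \<longlongrightarrow> l) (at_left x)"
    by (intro convergent_if_increments_le[where S = "{0..1}", OF K] eventually_at_left_period) auto
qed

lemma caglad_if_increments_le:
  assumes "periodic1 f" and U: "caglad U"
    and K: "\<And>x y. x \<in> {0..1} \<Longrightarrow> y \<in> {0..1} \<Longrightarrow> \<bar>f x - f y\<bar> \<le> K * \<bar>U x - U y\<bar>"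
  shows "caglad f"
proof (rule caglad_if_on_period[OF assms(1)])
  fix x :: real assume "0 < x" "x \<le> 1"
  then show "(f \<longlongrightarrow> f x) (at_left x)"
    using U by (intro tendsto_if_increments_le[where S = "{0..1}", OF K] eventually_at_left_period)
      (auto simp: caglad_def continuous_within)
next
  fix x :: real assume "0 \<le> x" "x < 1"
  moreover obtain u where "(U \<longlongrightarrow> u) (at_right x)" using U by (auto simp: caglad_def)
  ultimately show "\<exists>l. (f \<longlongrightarrow> l) (at_right x)"
    by (intro convergent_if_increments_le[where S = "{0..1}", OF K] eventually_at_right_period) auto
qed

text \<open>If \<open>U\<close> is increasing, then so is \<open>f + K U\<close>: hence \<open>f\<close> is a difference of monotone functions.\<close>

lemma measurable_if_increments_le:
  fixes f U :: "real \<Rightarrow> real"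
  assumes U: "mono_on S U"
    and K: "\<And>x y. x \<in> S \<Longrightarrow> y \<in> S \<Longrightarrow> \<bar>f x - f y\<bar> \<le> K * \<bar>U x - U y\<bar>"
  shows "f \<in> borel_measurable (restrict_space borel S)"
proof -
  have "mono_on S (\<lambda>x. f x + K * U x)"
  proof (rule mono_onI)
    fix x y assume *: "x \<in> S" "y \<in> S" "x \<le> y"
    then have "\<bar>U x - U y\<bar> = U y - U x" using mono_onD[OF U, of x y] by simp
    then have "\<bar>f x - f y\<bar> \<le> K * (U y - U x)" using K[of x y] * by simp
    then show "f x + K * U x \<le> f y + K * U y" by (simp add: algebra_simps)
  qed
  from borel_measurable_mono_on_fnc[OF this] borel_measurable_mono_on_fnc[OF U]
  have "(\<lambda>x. (f x + K * U x) - K * U x) \<in> borel_measurable (restrict_space borel S)"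
    by (intro borel_measurable_diff borel_measurable_times borel_measurable_const)
  then show ?thesis by simp
qed

section \<open>Averages over half-open intervals\<close>

text \<open>
  The closeness is only required almost everywhere: for \<open>c = 0\<close> this bounds the increments of a
  primitive, and for \<open>c\<close> a one-sided limit of \<open>f\<close> it gives its derivative.
\<close>

lemma set_integral_near_const:
  fixes f :: "'a \<Rightarrow> real"
  assumes A: "A \<in> sets M" "emeasure M A = ennreal m" "m \<ge> 0"
    and f: "set_integrable M A f"
    and near: "AE s in M. s \<in> A \<longrightarrow> \<bar>f s - c\<bar> \<le> e"
  shows "\<bar>(LINT s:A|M. f s) - c * m\<bar> \<le> e * m"
proof -
  have c: "set_integrable M A (\<lambda>_. t)" "(LINT s:A|M. t) = t * m" for t :: real
  proof -
    show "set_integrable M A (\<lambda>_. t)"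
      unfolding set_integrable_def using A
      by (intro integrable_scaleR_left integrable_real_indicator) auto
    show "(LINT s:A|M. t) = t * m"
      using A by (subst set_integral_const) (auto simp: measure_def)
  qed
  have d: "set_integrable M A (\<lambda>s. f s - c)"
    "(LINT s:A|M. f s - c) = (LINT s:A|M. f s) - c * m"
    using set_integral_diff[OF f c(1)[of c]] c(2) by auto
  have "\<bar>LINT s:A|M. f s - c\<bar> \<le> (LINT s:A|M. \<bar>f s - c\<bar>)"
    using set_integral_norm_bound[OF d(1)] by simp
  also have "\<dots> \<le> (LINT s:A|M. e)"
    using near by (intro set_integral_mono_AE set_integrable_abs d c)
  also have "\<dots> = e * m" by (rule c)
  finally show ?thesis by (simp add: d)
qed

text \<open>
  The absolute values on the right make the estimate insensitive to the sign of \<open>h\<close>, so that the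
  lemma covers the left and the right derivative at once.
\<close>

lemma diff_quot_tendsto:
  assumes U: "strict_mono U" and G: "G \<le> at 0"
    and near: "\<And>e. e > 0 \<Longrightarrow> eventually (\<lambda>h. \<bar>f (x + h) - f x - c * (U (x + h) - U x)\<bar>
                                    \<le> e * \<bar>U (x + h) - U x\<bar>) G"
  shows "(diff_quot U f x \<longlongrightarrow> c) G"
proof (rule tendstoI)
  fix e :: real assume "e > 0"
  have "eventually (\<lambda>h. h \<noteq> 0) G"
    using G by (rule filter_leD) (simp add: eventually_at_filter)
  moreover have "eventually (\<lambda>h. \<bar>f (x + h) - f x - c * (U (x + h) - U x)\<bar>
                                \<le> e / 2 * \<bar>U (x + h) - U x\<bar>) G"
    using \<open>e > 0\<close> by (intro near) simp
  ultimately show "eventually (\<lambda>h. dist (diff_quot U f x h) c < e) G"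
  proof eventually_elim
    case (elim h)
    define u where "u = U (x + h) - U x"
    have u: "u \<noteq> 0" using elim(1) strict_mono_eq[OF U, of "x + h" x] by (simp add: u_def)
    have "diff_quot U f x h - c = (f (x + h) - f x - c * u) / u"
      using u by (simp add: diff_quot_def u_def[symmetric] diff_divide_distrib)
    then have "dist (diff_quot U f x h) c = \<bar>f (x + h) - f x - c * u\<bar> / \<bar>u\<bar>"
      by (simp add: dist_real_def)
    also have "\<dots> \<le> e / 2"
      using u elim(2) by (simp add: divide_le_eq u_def)
    finally show ?case using \<open>e > 0\<close> by simp
  qed
qed

lemma primitive_dW_increment:
  fixes f k :: "real \<Rightarrow> real"
  assumes f: "\<And>x. x \<in> {0..1} \<Longrightarrow> f x - f 0 = (LINT s:{0<..x}|dW W. k s)"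
    and k: "set_integrable (dW W) {0<..1} k" and xy: "0 \<le> y" "y \<le> x" "x \<le> 1"
  shows "f x - f y = (LINT s:{y<..x}|dW W. k s)"
proof -
  have "(LINT s:{0<..y} \<union> {y<..x}|dW W. k s)
      = (LINT s:{0<..y}|dW W. k s) + (LINT s:{y<..x}|dW W. k s)"
    using xy by (intro set_integral_Un set_integrable_subset[OF k]) (auto simp: dW_def)
  moreover have "{0<..y} \<union> {y<..x} = {0<..x}" using xy by auto
  ultimately show ?thesis using f[of x] f[of y] xy by simp
qed

lemma primitive_dV_increment:
  fixes f k :: "real \<Rightarrow> real"
  assumes f: "\<And>x. x \<in> {0..1} \<Longrightarrow> f x - f 0 = (LINT s:{0..<x}|dV V. k s)"
    and k: "set_integrable (dV V) {0..<1} k" and xy: "0 \<le> y" "y \<le> x" "x \<le> 1"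
  shows "f x - f y = (LINT s:{y..<x}|dV V. k s)"
proof -
  have "(LINT s:{0..<y} \<union> {y..<x}|dV V. k s)
      = (LINT s:{0..<y}|dV V. k s) + (LINT s:{y..<x}|dV V. k s)"
    using xy by (intro set_integral_Un set_integrable_subset[OF k]) (auto simp: dV_def)
  moreover have "{0..<y} \<union> {y..<x} = {0..<x}" using xy by auto
  ultimately show ?thesis using f[of x] f[of y] xy by simp
qed

text \<open>
  The next two estimates serve twice: with \<open>c = 0\<close> for the regularity of a primitive, and with
  \<open>c\<close> the value of the integrand at an end point for its derivative. For \<open>dV\<close> the integrand \<open>g\<close>
  may be replaced by an almost everywhere equal function \<open>k\<close>, about which alone something is
  known at every point.
\<close>

lemma primitive_dW_near:
  assumes W: "strict_mono W" "cadlag W"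
    and f: "\<And>x. x \<in> {0..1} \<Longrightarrow> f x - f 0 = (LINT s:{0<..x}|dW W. k s)"
    and k: "set_integrable (dW W) {0<..1} k" and xy: "0 \<le> y" "y \<le> x" "x \<le> 1"
    and near: "\<And>s. y < s \<Longrightarrow> s \<le> x \<Longrightarrow> \<bar>k s - c\<bar> \<le> e"
  shows "\<bar>f x - f y - c * (W x - W y)\<bar> \<le> e * \<bar>W x - W y\<bar>"
proof -
  have *: "W y \<le> W x" using W(1) xy by (simp add: strict_mono_less_eq)
  have "\<bar>(LINT s:{y<..x}|dW W. k s) - c * (W x - W y)\<bar> \<le> e * (W x - W y)"
    using near xy * emeasure_dW[OF W xy(2)]
    by (intro set_integral_near_const set_integrable_subset[OF k]) (auto simp: dW_def)
  then show ?thesis using primitive_dW_increment[OF f k xy] * by simp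
qed

lemma primitive_dV_near:
  assumes V: "strict_mono V" "caglad V"
    and f: "\<And>x. x \<in> {0..1} \<Longrightarrow> f x - f 0 = (LINT s:{0..<x}|dV V. g s)"
    and g: "set_integrable (dV V) {0..<1} g" and xy: "0 \<le> y" "y \<le> x" "x \<le> 1"
    and gk: "AE s in dV V. s \<in> {0..<1} \<longrightarrow> g s = k s"
    and near: "\<And>s. y \<le> s \<Longrightarrow> s < x \<Longrightarrow> \<bar>k s - c\<bar> \<le> e"
  shows "\<bar>f x - f y - c * (V x - V y)\<bar> \<le> e * \<bar>V x - V y\<bar>"
proof -
  have *: "V y \<le> V x" using V(1) xy by (simp add: strict_mono_less_eq)
  have "AE s in dV V. s \<in> {y..<x} \<longrightarrow> \<bar>g s - c\<bar> \<le> e"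
    using gk by eventually_elim (use near xy in auto)
  then have "\<bar>(LINT s:{y..<x}|dV V. g s) - c * (V x - V y)\<bar> \<le> e * (V x - V y)"
    using xy * emeasure_dV[OF V xy(2)]
    by (intro set_integral_near_const set_integrable_subset[OF g]) (auto simp: dV_def)
  then show ?thesis using primitive_dV_increment[OF f g xy] * by simp
qed

section \<open>Fundamental theorem of calculus for the lateral derivatives\<close>

text \<open>
  The average of \<open>k\<close> over \<open>(x+h,x]\<close> tends to \<open>k x\<close> as \<open>h\<close> increases to \<open>0\<close>, by left continuity;
  the point \<open>x\<close>, which may be an atom of \<open>dW\<close>, contributes the value \<open>k x\<close> itself.
\<close>

lemma diff_quot_primitive_dW:
  assumes W: "strict_mono W" "cadlag W" and Wp: "\<And>x. W (x + 1) - W x = W 1 - W 0"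
    and per: "periodic1 f" "periodic1 k"
    and f: "\<And>x. x \<in> {0..1} \<Longrightarrow> f x - f 0 = (LINT s:{0<..x}|dW W. k s)"
    and k: "set_integrable (dW W) {0<..1} k" "caglad k"
  shows "(diff_quot W f x \<longlongrightarrow> k x) (at_left 0)"
proof (rule shift_invariant_left[where P = "\<lambda>x. (diff_quot W f x \<longlongrightarrow> k x) (at_left 0)"])
  fix x
  show "((diff_quot W f (x + 1) \<longlongrightarrow> k (x + 1)) (at_left 0)) =
    ((diff_quot W f x \<longlongrightarrow> k x) (at_left 0))"
    using per(2) by (simp add: diff_quot_shift1[OF per(1) Wp] periodic1_def)
next
  fix x :: real assume x: "0 < x" "x \<le> 1"
  show "(diff_quot W f x \<longlongrightarrow> k x) (at_left 0)"
  proof (rule diff_quot_tendsto[OF W(1)])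
    fix e :: real assume e: "e > 0"
    have "(k \<longlongrightarrow> k x) (at_left x)" using k(2) by (simp add: caglad_def continuous_within)
    from tendstoD[OF this e] obtain r where r: "r < x" "\<And>y. r < y \<Longrightarrow> y < x \<Longrightarrow> \<bar>k y - k x\<bar> < e"
      by (auto simp: eventually_at_left[OF x(1)] dist_real_def)
    have "eventually (\<lambda>h. h \<in> {max (r - x) (- x)<..<0}) (at_left 0)"
      using r(1) x by (intro eventually_at_left_real) simp
    then show "eventually (\<lambda>h. \<bar>f (x + h) - f x - k x * (W (x + h) - W x)\<bar>
                  \<le> e * \<bar>W (x + h) - W x\<bar>) (at_left 0)"
    proof eventually_elim
      case (elim h)
      have "\<bar>k s - k x\<bar> \<le> e" if "x + h < s" "s \<le> x" for s
        using r(2)[of s] that elim e by (cases "s = x") auto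
      then have "\<bar>f x - f (x + h) - k x * (W x - W (x + h))\<bar> \<le> e * \<bar>W x - W (x + h)\<bar>"
        using elim x by (intro primitive_dW_near[OF W f k(1)]) auto
      then show ?case by (simp add: algebra_simps abs_minus_commute)
    qed
  qed (simp add: at_le)
qed

text \<open>
  Here the interval is \<open>[x,x+h)\<close> and contains \<open>x\<close> for the same reason. The derivative is \<open>k\<close> at
  every point although the integrand \<open>g\<close> agrees with \<open>k\<close> only almost everywhere.
\<close>

lemma diff_quot_primitive_dV:
  assumes V: "strict_mono V" "caglad V" and Vp: "\<And>x. V (x + 1) - V x = V 1 - V 0"
    and per: "periodic1 f" "periodic1 k"
    and f: "\<And>x. x \<in> {0..1} \<Longrightarrow> f x - f 0 = (LINT s:{0..<x}|dV V. g s)"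
    and g: "set_integrable (dV V) {0..<1} g"
    and gk: "AE s in dV V. s \<in> {0..<1} \<longrightarrow> g s = k s" and k: "cadlag k"
  shows "(diff_quot V f x \<longlongrightarrow> k x) (at_right 0)"
proof (rule shift_invariant_right[where P = "\<lambda>x. (diff_quot V f x \<longlongrightarrow> k x) (at_right 0)"])
  fix x
  show "((diff_quot V f (x + 1) \<longlongrightarrow> k (x + 1)) (at_right 0)) =
    ((diff_quot V f x \<longlongrightarrow> k x) (at_right 0))"
    using per(2) by (simp add: diff_quot_shift1[OF per(1) Vp] periodic1_def)
next
  fix x :: real assume x: "0 \<le> x" "x < 1"
  show "(diff_quot V f x \<longlongrightarrow> k x) (at_right 0)"
  proof (rule diff_quot_tendsto[OF V(1)])
    fix e :: real assume e: "e > 0"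
    have "(k \<longlongrightarrow> k x) (at_right x)" using k by (simp add: cadlag_def continuous_within)
    from tendstoD[OF this e] obtain r where r: "r > x" "\<And>y. x < y \<Longrightarrow> y < r \<Longrightarrow> \<bar>k y - k x\<bar> < e"
      by (auto simp: eventually_at_right[OF x(2)] dist_real_def)
    have "eventually (\<lambda>h. h \<in> {0<..<min (r - x) (1 - x)}) (at_right 0)"
      using r(1) x by (intro eventually_at_right_real) simp
    then show "eventually (\<lambda>h. \<bar>f (x + h) - f x - k x * (V (x + h) - V x)\<bar>
                  \<le> e * \<bar>V (x + h) - V x\<bar>) (at_right 0)"
    proof eventually_elim
      case (elim h)
      have "\<bar>k s - k x\<bar> \<le> e" if "x \<le> s" "s < x + h" for s
        using r(2)[of s] that elim e by (cases "s = x") auto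
      then show ?case
        using elim x by (intro primitive_dV_near[OF V f g _ _ _ gk]) auto
    qed
  qed (simp add: at_le)
qed

section \<open>Iterated lateral derivatives of an eigenfunction\<close>

lemma diff_quot_scale: "diff_quot U (\<lambda>x. c * f x) x = (\<lambda>h. c * diff_quot U f x h)"
  by (simp add: diff_quot_def fun_eq_iff right_diff_distrib)

lemma C0_scale: "f \<in> C0 V \<Longrightarrow> (\<lambda>x. c * f x) \<in> C0 V"
  unfolding C0_def periodic1_def cadlag_def
  by (auto intro!: continuous_intros) (metis tendsto_mult_left)

lemma C1_scale: "f \<in> C1 W \<Longrightarrow> (\<lambda>x. c * f x) \<in> C1 W"
  unfolding C1_def periodic1_def caglad_def
  by (auto intro!: continuous_intros) (metis tendsto_mult_left)

text \<open>
  The two functions are exchanged by the lateral derivatives up to the factor \<open>c\<close>, so the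
  \<open>n\<close>-th iterated derivative of \<open>p\<close> is \<open>c ^ (n div 2)\<close> times \<open>p\<close> or \<open>d\<close>.
\<close>

lemma C_inf_if_eigenfunction:
  assumes p: "p \<in> C0 V" and d: "d \<in> C1 W"
    and pd: "\<And>x. (diff_quot W p x \<longlongrightarrow> d x) (at_left 0)"
    and dp: "\<And>x. (diff_quot V d x \<longlongrightarrow> c * p x) (at_right 0)"
  shows "p \<in> C_inf W V"
proof -
  have W: "(diff_quot W (\<lambda>x. t * p x) x \<longlongrightarrow> t * d x) (at_left 0)" for t x
    unfolding diff_quot_scale by (intro tendsto_intros pd)
  have V: "(diff_quot V (\<lambda>x. t * d x) x \<longlongrightarrow> t * (c * p x)) (at_right 0)" for t x
    unfolding diff_quot_scale by (intro tendsto_intros dp)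
  have DW: "DW_left W (\<lambda>x. t * p x) = (\<lambda>x. t * d x)" for t
    using tendsto_Lim[OF _ W] by (auto simp: DW_left_def fun_eq_iff)
  have DV: "DV_right V (\<lambda>x. t * d x) = (\<lambda>x. t * (c * p x))" for t
    using tendsto_Lim[OF _ V] by (auto simp: DV_right_def fun_eq_iff)
  have D: "D_iter W V n p = (\<lambda>x. c ^ (n div 2) * (if even n then p x else d x))" for n
  proof (induction n)
    case (Suc n)
    show ?case
    proof (cases "even n")
      case True
      then have "D_iter W V n p = (\<lambda>x. c ^ (n div 2) * p x)" using Suc by simp
      then show ?thesis using True by (simp add: DW)
    next
      case False
      then have "D_iter W V n p = (\<lambda>x. c ^ (n div 2) * d x)" using Suc by simp
      then show ?thesis using False by (simp add: DV) (simp add: mult_ac)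
    qed
  qed simp
  have "D_iter_exists W V n p" for n
  proof (induction n)
    case (Suc n)
    then show ?case
      using W[of "c ^ (n div 2)"] V[of "c ^ (n div 2)"]
      by (cases "even n")
        (auto simp: D W_left_differentiable_def V_right_differentiable_def simp del: D_iter.simps)
  qed simp
  moreover have "D_iter W V n p \<in> (if odd n then C1 W else C0 V)" for n
    using C0_scale[OF p] C1_scale[OF d] by (cases "even n") (simp_all add: D)
  ultimately show ?thesis using p by (simp add: C_inf_def C_smooth_def)
qed

section \<open>Integrability of primitives and of square integrable functions\<close>

lemma set_integrable_if_square_integrable:
  fixes f :: "'a \<Rightarrow> real"
  assumes A: "A \<in> sets M" "emeasure M A < \<infinity>" and f: "f \<in> borel_measurable M"
    and f2: "set_integrable M A (\<lambda>x. (f x)\<^sup>2)"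
  shows "set_integrable M A f"
proof (rule set_integrable_bound)
  have "set_integrable M A (\<lambda>_. 1 :: real)"
    unfolding set_integrable_def using A by (intro integrable_scaleR_left integrable_real_indicator) auto
  then show "set_integrable M A (\<lambda>x. 1 + (f x)\<^sup>2)" using f2 by (rule set_integral_add)
  show "set_borel_measurable M A f" unfolding set_borel_measurable_def using A f by measurable
  have "norm (f x) \<le> norm (1 + (f x)\<^sup>2)" for x
  proof -
    have "0 \<le> (\<bar>f x\<bar> - 1)\<^sup>2" by simp
    then have "2 * \<bar>f x\<bar> \<le> 1 + (f x)\<^sup>2" by (simp add: power2_diff)
    then show ?thesis by simp
  qed
  then show "AE x in M. x \<in> A \<longrightarrow> norm (f x) \<le> norm (1 + (f x)\<^sup>2)" by simp
qed

lemma set_integrable_if_bounded: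
  fixes f :: "real \<Rightarrow> real"
  assumes M: "sets M = sets borel" and f: "f \<in> borel_measurable (restrict_space borel S)"
    and S: "S \<in> sets borel" and A: "A \<in> sets borel" "A \<subseteq> S" "emeasure M A < \<infinity>"
    and B: "\<And>x. x \<in> S \<Longrightarrow> \<bar>f x\<bar> \<le> B"
  shows "set_integrable M A f"
  unfolding set_integrable_def
proof (rule integrableI_bounded_set[where A = A and B = B])
  have "(\<lambda>x. indicator S x *\<^sub>R f x) \<in> borel_measurable borel"
    using f S by (subst (asm) borel_measurable_restrict_space_iff) auto
  then have "(\<lambda>x. indicator A x *\<^sub>R (indicator S x *\<^sub>R f x)) \<in> borel_measurable borel"
    by (rule borel_measurable_scaleR[OF borel_measurable_indicator[OF A(1)]])
  moreover have "(\<lambda>x. indicator A x *\<^sub>R (indicator S x *\<^sub>R f x)) = (\<lambda>x. indicator A x *\<^sub>R f x)"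
    using A(2) by (auto simp: indicator_def fun_eq_iff)
  ultimately show "(\<lambda>x. indicator A x *\<^sub>R f x) \<in> borel_measurable M"
    by (simp add: measurable_cong_sets[OF M refl])
qed (use A B M in \<open>auto simp: indicator_def\<close>)

text \<open>
  For a merely integrable \<open>g\<close> the increments of the primitive \<open>G\<close> are controlled by the increasing
  function \<open>T\<close>. This makes \<open>G\<close> bounded and measurable, hence integrable against \<open>dW\<close>, before
  anything is known about the boundedness of \<open>g\<close>.
\<close>

lemma primitive_dV_total_variation:
  fixes g :: "real \<Rightarrow> real"
  assumes g: "set_integrable (dV V) {0..<1} g"
    and G: "\<And>y. G y = (LINT s:{0..<y}|dV V. g s)"
    and T: "\<And>y. T y = (LINT s:{0..<y}|dV V. \<bar>g s\<bar>)"
  shows "mono_on {0..1} T"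
    and "x \<in> {0..1} \<Longrightarrow> y \<in> {0..1} \<Longrightarrow> \<bar>G x - G y\<bar> \<le> \<bar>T x - T y\<bar>"
proof -
  have ag: "set_integrable (dV V) {0..<1} (\<lambda>s. \<bar>g s\<bar>)" using g by (rule set_integrable_abs)
  have *: "\<bar>G x - G y\<bar> \<le> T x - T y" if "0 \<le> y" "y \<le> x" "x \<le> 1" for x y
  proof -
    have "G x - G y = (LINT s:{y..<x}|dV V. g s)"
      by (rule primitive_dV_increment[OF _ g that]) (simp add: G set_lebesgue_integral_def)
    moreover have "T x - T y = (LINT s:{y..<x}|dV V. \<bar>g s\<bar>)"
      by (rule primitive_dV_increment[OF _ ag that]) (simp add: T set_lebesgue_integral_def)
    moreover have "set_integrable (dV V) {y..<x} g"
      using that by (intro set_integrable_subset[OF g]) (auto simp: dV_def)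
    ultimately show ?thesis using set_integral_norm_bound by force
  qed
  show "mono_on {0..1} T"
  proof (rule mono_onI)
    fix x y :: real assume "x \<in> {0..1}" "y \<in> {0..1}" "x \<le> y"
    then have "\<bar>G y - G x\<bar> \<le> T y - T x" by (intro *) auto
    then show "T x \<le> T y" by linarith
  qed
  show "\<bar>G x - G y\<bar> \<le> \<bar>T x - T y\<bar>" if "x \<in> {0..1}" "y \<in> {0..1}"
    using *[of x y] *[of y x] that by (cases "x \<le> y") (auto simp: abs_minus_commute)
qed

section \<open>Smoothness of eigenfunctions\<close>

theorem theorem6:
  fixes W V \<psi> :: "real \<Rightarrow> real" and lam :: real
  assumes "strict_mono W" and "strict_mono V"
    and "cadlag W" and "caglad V"
    and "\<And>x. W (x + 1) - W x = W 1 - W 0"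
    and "\<And>x. V (x + 1) - V x = V 1 - V 0"
    and "isCont W 0" and "isCont V 0"
    and "W 0 = 0" and "V 0 = 0"
    and "lam \<noteq> 0"
    and "\<psi> \<in> Laplacian_dom W V"
    and "eq_V V (\<lambda>x. - Laplacian W V \<psi> x) (\<lambda>x. lam * \<psi> x)"
  shows "\<exists>\<phi> \<in> C_inf W V. eq_V V \<phi> \<psi>"
proof -
  note W = assms(1,3) and V = assms(2,4)
  define g where "g = Laplacian W V \<psi>"
  have "Laplacian_graph W V \<psi> g"
    using assms(12) unfolding g_def Laplacian_def Laplacian_dom_def mem_Collect_eq by (rule someI_ex)
  define G where "G y = (LINT s:{0..<y}|dV V. g s)" for y
  from \<open>Laplacian_graph W V \<psi> g\<close> obtain a b where gL: "g \<in> L2V0 V"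
    and ab: "eq_V V \<psi> (\<lambda>x. a + b * W x + (LINT y:{0<..x}|dW W. G y))"
      "b * W 1 + (LINT y:{0<..1}|dW W. G y) = 0"
    unfolding Laplacian_graph_def G_def by blast
  have sets_dV: "sets (dV V) = sets borel" and sets_dW: "sets (dW W) = sets borel"
    by (simp_all add: dV_def dW_def)
  have fin: "emeasure (dV V) {0..<1} < \<infinity>" "emeasure (dW W) {0<..1} < \<infinity>"
    using emeasure_dV[OF V, of 0 1] emeasure_dW[OF W, of 0 1] by auto
  have g_meas: "g \<in> borel_measurable borel"
    using gL unfolding L2V0_def L2V_def by blast
  have g: "set_integrable (dV V) {0..<1} g"
  proof (rule set_integrable_if_square_integrable[OF _ fin(1)])
    show "{0..<1} \<in> sets (dV V)" by (simp add: sets_dV)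
    show "g \<in> borel_measurable (dV V)"
      using g_meas unfolding measurable_cong_sets[OF sets_dV refl] .
    show "set_integrable (dV V) {0..<1} (\<lambda>x. (g x)\<^sup>2)"
      using gL unfolding L2V0_def L2V_def by blast
  qed
  have G01: "G 0 = 0" "G 1 = 0"
  proof -
    show "G 0 = 0" by (simp add: G_def set_lebesgue_integral_def)
    show "G 1 = 0" using gL unfolding L2V0_def G_def by blast
  qed

  define T where "T y = (LINT s:{0..<y}|dV V. \<bar>g s\<bar>)" for y
  note TG = primitive_dV_total_variation[OF g G_def T_def]
  have T0: "T 0 = 0" by (simp add: T_def set_lebesgue_integral_def)
  have G_meas: "G \<in> borel_measurable (restrict_space borel {0..1})"
    using TG by (intro measurable_if_increments_le[where U = T and K = 1]) auto
  have G_bound: "\<bar>G y\<bar> \<le> T 1" if "y \<in> {0..1}" for y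
    using TG(2)[of y 0] that G01 T0 mono_onD[OF TG(1), of 0 y] mono_onD[OF TG(1), of y 1] by auto
  have G_int: "set_integrable (dW W) {0<..1} G"
    by (rule set_integrable_if_bounded[OF sets_dW G_meas _ _ _ _ G_bound]) (use fin in auto)

  \<comment> \<open>The periodic extensions. At the right end \<open>1\<close> of the period, where \<open>frac\<close> jumps to \<open>0\<close>, the
    formulas persist: for \<open>\<phi>\<close> by the boundary condition and for \<open>d\<close> because \<open>G 1 = G 0\<close>.\<close>
  define \<phi> where "\<phi> x = a + b * W (frac x) + (LINT y:{0<..frac x}|dW W. G y)" for x
  define d where "d x = b + G (frac x)" for x
  have per: "periodic1 \<phi>" "periodic1 d" by (simp_all add: periodic1_def \<phi>_def d_def frac_1_eq)
  have \<phi>: "\<phi> x = a + b * W x + (LINT y:{0<..x}|dW W. G y)" if "x \<in> {0..1}" for x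
    using that ab(2) assms(9)
    by (cases "x = 1") (auto simp: \<phi>_def set_lebesgue_integral_def algebra_simps)
  have d: "d x = b + G x" if "x \<in> {0..1}" for x
    using that G01 by (cases "x = 1") (auto simp: d_def)

  have b_int: "set_integrable (dW W) {0<..1} (\<lambda>_. b)"
    by (rule set_integrable_if_bounded[OF sets_dW, where S = UNIV and B = "\<bar>b\<bar>"])
      (use fin in auto)
  have d_int: "set_integrable (dW W) {0<..1} d"
    using set_integral_add(1)[OF b_int G_int]
    by (rule set_integrable_cong[THEN iffD1, rotated -1]) (auto simp: d)
  have \<phi>_prim: "\<phi> x - \<phi> 0 = (LINT s:{0<..x}|dW W. d s)" if x: "x \<in> {0..1}" for x
  proof -
    have sub: "{0<..x} \<subseteq> {0<..1}" "{0<..x} \<in> sets (dW W)" using x by (auto simp: sets_dW)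
    have "(LINT s:{0<..x}|dW W. d s) = (LINT s:{0<..x}|dW W. b + G s)"
      using x by (intro set_lebesgue_integral_cong) (auto simp: d sets_dW)
    also have "\<dots> = (LINT s:{0<..x}|dW W. b) + (LINT s:{0<..x}|dW W. G s)"
      using sub by (intro set_integral_add set_integrable_subset[OF b_int] set_integrable_subset[OF G_int])
    also have "(LINT s:{0<..x}|dW W. b) = b * W x"
      using x emeasure_dW[OF W, of 0 x] strict_mono_less_eq[OF W(1), of 0 x] assms(9) sub
      by (subst set_integral_const) (auto simp: measure_def)
    finally show ?thesis using \<phi>[OF x] \<phi>[of 0] assms(9) by (simp add: set_lebesgue_integral_def)
  qed

  \<comment> \<open>\<open>d\<close> is bounded, so the increments of \<open>\<phi>\<close> are controlled by those of \<open>W\<close>.\<close>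
  define K where "K = \<bar>b\<bar> + T 1"
  have d_bound: "\<bar>d x\<bar> \<le> K" if "x \<in> {0..1}" for x
    using G_bound[OF that] by (simp add: d[OF that] K_def)
  have \<phi>_incr: "\<bar>\<phi> x - \<phi> y\<bar> \<le> K * \<bar>W x - W y\<bar>" if "x \<in> {0..1}" "y \<in> {0..1}" for x y
  proof -
    have *: "\<bar>\<phi> x - \<phi> y\<bar> \<le> K * \<bar>W x - W y\<bar>" if "0 \<le> y" "y \<le> x" "x \<le> 1" for x y
      using primitive_dW_near[OF W \<phi>_prim d_int that, of 0 K] d_bound that by auto
    show ?thesis using *[of x y] *[of y x] that by (cases "x \<le> y") (auto simp: abs_minus_commute)
  qed
  have \<phi>_cadlag: "cadlag \<phi>" by (rule cadlag_if_increments_le[OF per(1) W(2) \<phi>_incr])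
  have W_mono: "mono_on {0..1} W"
    using W(1) by (auto intro!: mono_onI simp: strict_mono_less_eq)
  have \<phi>_meas: "\<phi> \<in> borel_measurable (restrict_space borel {0..1})"
    by (rule measurable_if_increments_le[OF W_mono \<phi>_incr])

  \<comment> \<open>The eigenvalue equation enters here, and only as an equality almost everywhere.\<close>
  have \<phi>\<psi>: "eq_V V \<phi> \<psi>"
    using ab(1) unfolding eq_V_def by eventually_elim (auto simp: \<phi>)
  have g\<phi>: "AE s in dV V. s \<in> {0..<1} \<longrightarrow> g s = - lam * \<phi> s"
    using \<phi>\<psi> assms(13) unfolding eq_V_def g_def by eventually_elim auto
  have \<phi>_zero: "(LINT x:{0..<1}|dV V. \<phi> x) = 0"
  proof -
    have "(\<lambda>x. indicator {0..1} x *\<^sub>R \<phi> x) \<in> borel_measurable borel"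
      using \<phi>_meas by (subst (asm) borel_measurable_restrict_space_iff) auto
    then have m: "(\<lambda>x. indicator {0..1} x *\<^sub>R \<phi> x) \<in> borel_measurable (dV V)"
      by (simp add: measurable_cong_sets[OF sets_dV refl])
    have gm: "(\<lambda>x. - g x / lam) \<in> borel_measurable (dV V)"
      using g_meas unfolding measurable_cong_sets[OF sets_dV refl]
      by (intro borel_measurable_divide borel_measurable_uminus borel_measurable_const)
    have "(LINT x:{0..<1}|dV V. \<phi> x) = (LINT x:{0..<1}|dV V. indicator {0..1} x *\<^sub>R \<phi> x)"
      by (rule set_lebesgue_integral_cong) (auto simp: sets_dV)
    also have "\<dots> = (LINT x:{0..<1}|dV V. - g x / lam)"
    proof (rule set_lebesgue_integral_cong_AE[OF _ m gm])
      show "AE x\<in>{0..<1} in dV V. indicator {0..1} x *\<^sub>R \<phi> x = - g x / lam"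
        using g\<phi> by eventually_elim (use assms(11) in auto)
    qed (simp add: sets_dV)
    also have "\<dots> = - (LINT x:{0..<1}|dV V. g x) / lam"
      by (simp add: set_lebesgue_integral_def)
    also have "\<dots> = 0" using gL by (simp add: L2V0_def)
    finally show ?thesis .
  qed
  have "\<phi> \<in> C0 V" using per \<phi>_cadlag \<phi>_zero by (simp add: C0_def)

  have d_prim: "d x - d 0 = (LINT s:{0..<x}|dV V. g s)" if "x \<in> {0..1}" for x
    using that by (simp add: d G01) (simp add: G_def)
  \<comment> \<open>As \<open>\<phi>\<close> is bounded, \<open>g\<close> is bounded almost everywhere, and \<open>V\<close> controls the increments of \<open>d\<close>.\<close>
  define L where "L = \<bar>lam\<bar> * (\<bar>\<phi> 0\<bar> + K * W 1)"
  have L: "\<bar>lam * \<phi> s\<bar> \<le> L" if "s \<in> {0..1}" for s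
  proof -
    have K: "K \<ge> 0" using d_bound[of 0] by simp
    have "\<bar>W s - W 0\<bar> \<le> W 1"
      using that assms(9) strict_mono_less_eq[OF W(1), of 0 s] strict_mono_less_eq[OF W(1), of s 1]
      by auto
    then have "\<bar>\<phi> s - \<phi> 0\<bar> \<le> K * W 1"
      using \<phi>_incr[of s 0] that K by (smt (verit) atLeastAtMost_iff mult_left_mono)
    then have "\<bar>\<phi> s\<bar> \<le> \<bar>\<phi> 0\<bar> + K * W 1" by simp
    then show ?thesis by (simp add: L_def abs_mult mult_left_mono)
  qed
  have d_incr: "\<bar>d x - d y\<bar> \<le> L * \<bar>V x - V y\<bar>" if "x \<in> {0..1}" "y \<in> {0..1}" for x y
  proof -
    have *: "\<bar>d x - d y\<bar> \<le> L * \<bar>V x - V y\<bar>" if "0 \<le> y" "y \<le> x" "x \<le> 1" for x y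
      using primitive_dV_near[OF V d_prim g that g\<phi>, of 0 L] L that by auto
    show ?thesis using *[of x y] *[of y x] that by (cases "x \<le> y") (auto simp: abs_minus_commute)
  qed
  have d_caglad: "caglad d" by (rule caglad_if_increments_le[OF per(2) V(2) d_incr])
  have "\<phi> 1 = \<phi> 0" using per(1) unfolding periodic1_def by (metis add_0)
  then have "(LINT x:{0<..1}|dW W. d x) = 0" using \<phi>_prim[of 1] by simp
  then have "d \<in> C1 W" using per d_caglad by (simp add: C1_def)

  have "(diff_quot W \<phi> x \<longlongrightarrow> d x) (at_left 0)" for x
    by (rule diff_quot_primitive_dW[OF W assms(5) per \<phi>_prim d_int d_caglad])
  moreover have "(diff_quot V d x \<longlongrightarrow> - lam * \<phi> x) (at_right 0)" for x
  proof (rule diff_quot_primitive_dV[OF V assms(6) per(2) _ d_prim g g\<phi>])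
    show "periodic1 (\<lambda>x. - lam * \<phi> x)" using per(1) by (simp add: periodic1_def)
    show "cadlag (\<lambda>x. - lam * \<phi> x)" using C0_scale[OF \<open>\<phi> \<in> C0 V\<close>, of "- lam"] by (simp add: C0_def)
  qed
  ultimately have "\<phi> \<in> C_inf W V"
    using \<open>\<phi> \<in> C0 V\<close> \<open>d \<in> C1 W\<close> by (intro C_inf_if_eigenfunction)
  with \<phi>\<psi> show ?thesis by blast
qed

end
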